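(* Let $G$ be a tree of order $n\geq 2$. Then $\operatorname{avd}(G)\leq \frac{2n}{3}$. Moreover, $\operatorname{avd}(G)=\frac{2n}{3}$ if and only if every non-leaf vertex of $G$ is a support vertex with one or two leaf neighbors.
   Context: All graphs are finite, simple and undirected. A set $S\subseteq V(G)$ is a dominating set of $G$ if every vertex of $V(G)\setminus S$ is adjacent to some vertex of $S$. Let $\mathcal{D}(G)$ be the family of all dominating sets of $G$. The average order of a dominating set of $G$ is $\operatorname{avd}(G)=\frac{\sum_{S\in\mathcal{D}(G)}|S|}{|\mathcal{D}(G)|}$. A leaf is a vertex of degree one; a support vertex is a vertex adjacent to at least one leaf; the leaf neighbors of a vertex $u$ are the leaves adjacent to $u$. *)

theory Defs
  imports Complex_Main "Graph_Theory.Graph_Theory"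
begin

text \<open>
  A finite simple undirected graph is a \<^locale>\<open>pair_graph\<close>: an edge between
  \<open>u\<close> and \<open>v\<close> is the pair of opposite arcs \<open>(u, v)\<close> and \<open>(v, u)\<close>, so
  \<^const>\<open>out_degree\<close> is the degree of a vertex. The library predicate
  \<^const>\<open>tree\<close> is not usable for such graphs, because the closed walk \<open>u, v, u\<close>
  along a single edge counts as a \<open>cycle\<close> there; the cycles of an undirected simple
  graph are those of length at least 3.
\<close>

definition undirected_tree :: "'a pair_pre_digraph \<Rightarrow> bool" where
  "undirected_tree G \<longleftrightarrow>
     pair_graph G \<and> connected (with_proj G) \<and>
     \<not> (\<exists>p. pre_digraph.cycle (with_proj G) p \<and> 3 \<le> length p)"

definition leaf :: "'a pair_pre_digraph \<Rightarrow> 'a \<Rightarrow> bool" where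
  "leaf G v \<longleftrightarrow> v \<in> pverts G \<and> out_degree (with_proj G) v = 1"

definition leaf_neighbors :: "'a pair_pre_digraph \<Rightarrow> 'a \<Rightarrow> 'a set" where
  "leaf_neighbors G u = {w. leaf G w \<and> (u, w) \<in> parcs G}"

definition support_vertex :: "'a pair_pre_digraph \<Rightarrow> 'a \<Rightarrow> bool" where
  "support_vertex G u \<longleftrightarrow> u \<in> pverts G \<and> (\<exists>w. leaf G w \<and> (u, w) \<in> parcs G)"

definition dominating_set :: "'a pair_pre_digraph \<Rightarrow> 'a set \<Rightarrow> bool" where
  "dominating_set G S \<longleftrightarrow>
     S \<subseteq> pverts G \<and> (\<forall>v \<in> pverts G - S. \<exists>u \<in> S. (v, u) \<in> parcs G)"

definition dominating_sets :: "'a pair_pre_digraph \<Rightarrow> 'a set set" where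
  "dominating_sets G = {S. dominating_set G S}"

definition avd :: "'a pair_pre_digraph \<Rightarrow> real" where
  "avd G = (\<Sum>S \<in> dominating_sets G. real (card S)) / real (card (dominating_sets G))"

end

theory Submission
  imports Defs
begin

text \<open>
  Removing a non-critical vertex from a dominating set and adding a missing vertex to one are
  inverse operations, so the claim \<open>avd G \<le> 2 n / 3\<close> says that, summed over all dominating sets
  \<open>S\<close>, there are at most as many critical vertices in \<open>S\<close> as vertices outside \<open>S\<close>.
  A critical \<open>u\<close> with a private neighbor outside \<open>S\<close> is paid for by that neighbor, leaving a surplus
  of \<open>card (priv S u) - 1\<close>. The other critical vertices (\<open>lone S\<close>) are isolated in \<open>S\<close>, and
  all their neighbors have at least two neighbors in \<open>S\<close>. Assign to each vertex a fixed neighbor, and let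
  \<open>K\<close> be the set of the lone vertices assigned to \<open>u\<close>. If there is neither a triangle nor a
  4-cycle, then for every nonempty \<open>I \<subseteq> K\<close> the set \<open>insert u (S - I)\<close> is dominating, and
  \<open>I\<close> is exactly the set of private neighbors of \<open>u\<close> in it, so that \<open>S\<close> and \<open>I\<close> can be recovered.
  The vertex \<open>u\<close> itself and the surpluses of these sets pay for \<open>K\<close>, because a set with \<open>k\<close> elements
  satisfies \<open>k \<le> 1 + (\<Sum>I\<in>Pow K. card I - 1)\<close>, with equality only for \<open>k \<in> {1, 2}\<close>.
\<close>

section \<open>A counting inequality for the subsets of a finite set\<close>

lemma card_le_Suc_sum_Pow:
  assumes "finite K"
  shows "card K \<le> Suc (\<Sum>I\<in>Pow K. card I - 1)"
    and "card K = Suc (\<Sum>I\<in>Pow K. card I - 1) \<Longrightarrow> card K \<in> {1, 2}"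
proof -
  have "card K < Suc (\<Sum>I\<in>Pow K. card I - 1)" if "3 \<le> card K"
  proof -
    have "K \<noteq> {}" using that by auto
    then obtain x where x: "x \<in> K" by auto
    \<comment> \<open>With k for \<open>card K\<close>, these two subsets contribute (k - 1) + (k -
      2), which is at least k once k is at least 3.\<close>
    have "card K \<le> (\<Sum>I\<in>{K, K - {x}}. card I - 1)"
      using x that by (subst sum.insert) auto
    also have "\<dots> \<le> (\<Sum>I\<in>Pow K. card I - 1)"
      using assms by (intro sum_mono2) auto
    finally show ?thesis by simp
  qed
  moreover have "card K \<le> Suc (\<Sum>I\<in>Pow K. card I - 1)" if "card K = 2"
  proof -
    have "(\<Sum>I\<in>{K}. card I - 1) \<le> (\<Sum>I\<in>Pow K. card I - 1)"
      using assms by (intro sum_mono2) auto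
    with that show ?thesis by simp
  qed
  moreover have "card K = 0 \<or> card K = 1 \<or> card K = 2 \<or> 3 \<le> card K" by linarith
  ultimately show "card K \<le> Suc (\<Sum>I\<in>Pow K. card I - 1)"
    and "card K = Suc (\<Sum>I\<in>Pow K. card I - 1) \<Longrightarrow> card K \<in> {1, 2}"
    by auto
qed

section \<open>Critical vertices in graphs without 3-cycles and 4-cycles\<close>

text \<open>The counting is local, so trees are replaced by graphs of girth at least five without
  isolated vertices, forests included.\<close>

locale girth_five_graph =
  fixes V :: "'a set" and N :: "'a \<Rightarrow> 'a set"
  assumes finite_V: "finite V"
    and N_subset: "N v \<subseteq> V"
    and N_sym: "u \<in> N v \<Longrightarrow> v \<in> N u"
    and N_irrefl: "v \<notin> N v"
    and N_nonempty: "v \<in> V \<Longrightarrow> N v \<noteq> {}"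
    and no_triangle: "u \<in> N v \<Longrightarrow> w \<in> N v \<Longrightarrow> w \<notin> N u"
    and no_square: "x \<in> N u \<Longrightarrow> x \<in> N w \<Longrightarrow> y \<in> N u \<Longrightarrow> y \<in> N w \<Longrightarrow> u \<noteq> w \<Longrightarrow> x = y"
begin

definition Dom :: "'a set set" where
  "Dom = {S. S \<subseteq> V \<and> (\<forall>v\<in>V - S. N v \<inter> S \<noteq> {})}"

definition crit :: "'a set \<Rightarrow> 'a set" where
  "crit S = {v \<in> S. S - {v} \<notin> Dom}"

text \<open>These are the external private neighbors of \<open>u\<close> with respect to
  \<open>S\<close>.\<close>

definition priv :: "'a set \<Rightarrow> 'a \<Rightarrow> 'a set" where
  "priv S u = {v \<in> V - S. N v \<inter> S = {u}}"

text \<open>For a dominating \<open>S\<close> these are the outside vertices dominated at least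
  twice.\<close>

definition multi :: "'a set \<Rightarrow> 'a set" where
  "multi S = {v \<in> V - S. \<forall>u. N v \<inter> S \<noteq> {u}}"

definition lone :: "'a set \<Rightarrow> 'a set" where
  "lone S = {v \<in> S. N v \<inter> S = {} \<and> priv S v = {}}"

definition nb :: "'a \<Rightarrow> 'a" where
  "nb v = (SOME u. u \<in> N v)"

definition lone_at :: "'a set \<Rightarrow> 'a \<Rightarrow> 'a set" where
  "lone_at S u = {v \<in> lone S. nb v = u}"

text \<open>The balance of \<open>u\<close> over all dominating sets: its surplus private neighbors,
  plus one unit whenever it is dominated at least twice from outside \<open>S\<close>, minus the
  lone vertices assigned to it. Truncated subtraction gives surplus 0 when there is no private
  neighbor.\<close>

definition slack :: "'a \<Rightarrow> int" where
  "slack u = (\<Sum>S\<in>{S \<in> Dom. u \<in> S}. int (card (priv S u) - 1)) +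
     (\<Sum>S\<in>{S \<in> Dom. u \<in> multi S}. 1 - int (card (lone_at S u)))"

lemma nb_in: "v \<in> V \<Longrightarrow> nb v \<in> N v"
  unfolding nb_def using N_nonempty by (simp add: some_in_eq)

lemma DomD: "S \<in> Dom \<Longrightarrow> S \<subseteq> V" "S \<in> Dom \<Longrightarrow> v \<in> V \<Longrightarrow> v \<notin> S \<Longrightarrow> N v \<inter> S \<noteq> {}"
  by (auto simp: Dom_def)

lemma finite_Dom: "finite Dom"
  by (rule finite_subset[of _ "Pow V"]) (auto simp: Dom_def finite_V)

lemma finite_in_Dom: "S \<in> Dom \<Longrightarrow> finite S"
  using DomD(1) finite_V finite_subset by blast

lemma insert_Dom: "S \<in> Dom \<Longrightarrow> v \<in> V \<Longrightarrow> insert v S \<in> Dom"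
  by (auto simp: Dom_def)

lemma finite_priv: "finite (priv S u)" and finite_multi: "finite (multi S)"
  by (auto simp: priv_def multi_def finite_V)

lemma finite_lone: "S \<in> Dom \<Longrightarrow> finite (lone S)"
  by (auto simp: lone_def finite_in_Dom)

lemma finite_lone_at: "S \<in> Dom \<Longrightarrow> finite (lone_at S u)"
  by (auto simp: lone_at_def finite_lone)

section \<open>Double counting of critical vertices\<close>

lemma sum_card_noncritical:
  "(\<Sum>S\<in>Dom. card (S - crit S)) = (\<Sum>S\<in>Dom. card (V - S))"
proof -
  have "bij_betw (\<lambda>(S, v). (S - {v}, v)) (SIGMA S:Dom. S - crit S) (SIGMA S:Dom. V - S)"
    by (rule bij_betw_byWitness[where f' = "\<lambda>(S, v). (insert v S, v)"])
      (auto simp: crit_def insert_absorb insert_Dom dest: DomD)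
  then have "card (SIGMA S:Dom. S - crit S) = card (SIGMA S:Dom. V - S)"
    by (rule bij_betw_same_card)
  then show ?thesis
    using finite_V finite_in_Dom by (simp add: finite_Dom card_SigmaI)
qed

text \<open>A vertex left undominated when \<open>v\<close> is removed is either outside
  \<open>S\<close>, hence a private neighbor of \<open>v\<close>, or \<open>v\<close> itself, which
  is then isolated in \<open>S\<close>.\<close>

lemma crit_iff:
  assumes "S \<in> Dom" "v \<in> S"
  shows "v \<in> crit S \<longleftrightarrow> priv S v \<noteq> {} \<or> v \<in> lone S"
proof
  assume "v \<in> crit S"
  then obtain x where x: "x \<in> V" "x \<notin> S - {v}" "N x \<inter> (S - {v}) = {}"
    using DomD(1)[OF assms(1)] by (auto simp: crit_def Dom_def)
  show "priv S v \<noteq> {} \<or> v \<in> lone S"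
  proof (cases "x = v")
    case True
    then show ?thesis using x N_irrefl[of v] assms(2) by (auto simp: lone_def)
  next
    case False
    then have "x \<in> priv S v" using x DomD(2)[OF assms(1), of x] by (auto simp: priv_def)
    then show ?thesis by auto
  qed
next
  assume "priv S v \<noteq> {} \<or> v \<in> lone S"
  then show "v \<in> crit S"
  proof
    assume "priv S v \<noteq> {}"
    then obtain x where "x \<in> V - (S - {v})" "N x \<inter> (S - {v}) = {}" by (auto simp: priv_def)
    then show ?thesis using assms by (auto simp: crit_def Dom_def)
  next
    assume "v \<in> lone S"
    then have "v \<in> V - (S - {v})" "N v \<inter> (S - {v}) = {}"
      using DomD(1)[OF assms(1)] by (auto simp: lone_def)
    then show ?thesis using assms by (auto simp: crit_def Dom_def)
  qed
qed

text \<open>The sets \<open>priv S u\<close> and \<open>multi S\<close> partition the complement of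
  \<open>S\<close>. Each critical vertex that is not lone uses up one of its private neighbors, and
  the rest is surplus.\<close>

lemma card_complement_add_lone:
  assumes "S \<in> Dom"
  shows "card (V - S) + card (lone S)
       = card (crit S) + card (multi S) + (\<Sum>u\<in>S. card (priv S u) - 1)"
proof -
  let ?A = "{u \<in> S. priv S u \<noteq> {}}"
  note fin = finite_in_Dom[OF assms] finite_lone[OF assms] finite_priv finite_multi
  have "V - S = (\<Union>u\<in>S. priv S u) \<union> multi S"
    by (auto simp: priv_def multi_def)
  moreover have "(\<Union>u\<in>S. priv S u) \<inter> multi S = {}"
    by (auto simp: priv_def multi_def)
  moreover have "card (\<Union>u\<in>S. priv S u) = (\<Sum>u\<in>S. card (priv S u))"
    by (rule card_UN_disjoint) (use fin in \<open>auto simp: priv_def\<close>)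
  ultimately have compl: "card (V - S) = (\<Sum>u\<in>S. card (priv S u)) + card (multi S)"
    using fin by (simp add: card_Un_disjoint)
  have "crit S = ?A \<union> lone S"
    using crit_iff[OF assms] by (auto simp: crit_def lone_def)
  moreover have "?A \<inter> lone S = {}" by (auto simp: lone_def)
  ultimately have crit: "card (crit S) = card ?A + card (lone S)"
    using fin by (simp add: card_Un_disjoint)
  \<comment> \<open>The indicator restores the unit that truncated subtraction removes exactly from
    the nonempty sets.\<close>
  have "(\<Sum>u\<in>S. card (priv S u)) = (\<Sum>u\<in>S. (card (priv S u) - 1) + of_bool (priv S u \<noteq> {}))"
    using fin by (intro sum.cong) (auto simp: Suc_leI card_gt_0_iff)
  also have "\<dots> = (\<Sum>u\<in>S. card (priv S u) - 1) + card ?A"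
    using fin by (simp add: sum.distrib Int_def)
  finally show ?thesis using compl crit by simp
qed

text \<open>Were \<open>v\<close> the only neighbor of \<open>nb v\<close> in \<open>S\<close>, then
  \<open>nb v\<close> would be a private neighbor of \<open>v\<close>. Hence every lone vertex is
  charged to a vertex that owns a spare unit.\<close>

lemma nb_lone_in_multi:
  assumes "S \<in> Dom" "v \<in> lone S"
  shows "nb v \<in> multi S"
proof -
  have v: "v \<in> S" "N v \<inter> S = {}" "priv S v = {}" "nb v \<in> N v"
    using assms nb_in DomD(1)[OF assms(1)] by (auto simp: lone_def)
  then have u: "nb v \<in> V - S" "v \<in> N (nb v)" using N_subset N_sym by auto
  have "N (nb v) \<inter> S \<noteq> {w}" for w
    using u v by (cases "w = v") (auto simp: priv_def)
  then show ?thesis using u by (auto simp: multi_def)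
qed

lemma sum_swap_filter:
  fixes g :: "'a set \<Rightarrow> 'a \<Rightarrow> int"
  assumes "\<And>S. S \<in> Dom \<Longrightarrow> A S \<subseteq> V"
  shows "(\<Sum>S\<in>Dom. \<Sum>u\<in>A S. g S u) = (\<Sum>u\<in>V. \<Sum>S\<in>{S \<in> Dom. u \<in> A S}. g S u)"
proof -
  have "(\<Sum>S\<in>Dom. \<Sum>u\<in>A S. g S u) = (\<Sum>S\<in>Dom. \<Sum>u\<in>{u \<in> V. u \<in> A S}. g S u)"
    using assms by (intro sum.cong) auto
  also have "\<dots> = (\<Sum>u\<in>V. \<Sum>S\<in>{S \<in> Dom. u \<in> A S}. g S u)"
    by (rule sum.swap_restrict) (auto simp: finite_Dom finite_V)
  finally show ?thesis .
qed

text \<open>Reduces the bound on the average to the sign of each \<open>slack u\<close>, and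
  equality to all of them vanishing.\<close>

lemma sum_slack:
  "(\<Sum>u\<in>V. slack u) = 2 * int (card V) * int (card Dom) - 3 * (\<Sum>S\<in>Dom. int (card S))"
proof -
  have lone: "int (card (lone S)) = (\<Sum>u\<in>multi S. int (card (lone_at S u)))" if "S \<in> Dom" for S
  proof -
    have "lone S = (\<Union>u\<in>multi S. lone_at S u)"
      using nb_lone_in_multi[OF that] by (auto simp: lone_at_def)
    moreover have "card (\<Union>u\<in>multi S. lone_at S u) = (\<Sum>u\<in>multi S. card (lone_at S u))"
      using finite_multi finite_lone_at[OF that]
      by (intro card_UN_disjoint) (auto simp: lone_at_def)
    ultimately show ?thesis by simp
  qed
  have "(\<Sum>u\<in>V. slack u) =
      (\<Sum>S\<in>Dom. (\<Sum>u\<in>S. int (card (priv S u) - 1)) + (\<Sum>u\<in>multi S. 1 - int (card (lone_at S u))))"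
    unfolding slack_def sum.distrib
    by (subst (1 2) sum_swap_filter) (auto simp: multi_def dest: DomD)
  also have "\<dots> = (\<Sum>S\<in>Dom. int (card (V - S)) - int (card (crit S)))"
  proof (rule sum.cong)
    fix S assume S: "S \<in> Dom"
    have "int (card (V - S)) + int (card (lone S))
       = int (card (crit S)) + int (card (multi S)) + (\<Sum>u\<in>S. int (card (priv S u) - 1))"
      using card_complement_add_lone[OF S] by (metis of_nat_add of_nat_sum)
    then show "(\<Sum>u\<in>S. int (card (priv S u) - 1)) + (\<Sum>u\<in>multi S. 1 - int (card (lone_at S u)))
        = int (card (V - S)) - int (card (crit S))"
      using lone[OF S] by (simp add: sum_subtractf)
  qed simp
  \<comment> \<open>This holds only after summation over \<open>Dom\<close>:
    \<open>sum_card_noncritical\<close> trades the noncritical vertices for the complements.\<close>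
  also have "\<dots> = (\<Sum>S\<in>Dom. 2 * int (card (V - S)) - int (card S))"
  proof -
    have "(\<Sum>S\<in>Dom. int (card S) - int (card (crit S))) = (\<Sum>S\<in>Dom. int (card (S - crit S)))"
    proof (rule sum.cong)
      fix S assume "S \<in> Dom"
      moreover have "crit S \<subseteq> S" by (auto simp: crit_def)
      ultimately show "int (card S) - int (card (crit S)) = int (card (S - crit S))"
        using finite_in_Dom by (simp add: card_Diff_subset finite_subset card_mono of_nat_diff)
    qed simp
    also have "\<dots> = (\<Sum>S\<in>Dom. int (card (V - S)))"
      using sum_card_noncritical by (metis of_nat_sum)
    finally show ?thesis by (simp add: sum_subtractf sum_distrib_left[symmetric])
  qed
  also have "\<dots> = (\<Sum>S\<in>Dom. 2 * int (card V) - 3 * int (card S))"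
    using finite_V finite_in_Dom DomD(1)
    by (intro sum.cong) (auto simp: card_Diff_subset card_mono of_nat_diff)
  finally show ?thesis by (simp add: sum_subtractf sum_distrib_left)
qed

section \<open>Exchanging lone vertices for their assigned neighbor\<close>

lemma exchange_lone:
  assumes S: "S \<in> Dom" and u: "u \<in> multi S" and I: "I \<subseteq> lone_at S u"
  shows "insert u (S - I) \<in> Dom" and "priv (insert u (S - I)) u = I"
proof -
  have uV: "u \<in> V" "u \<notin> S" using u by (auto simp: multi_def)
  have I': "i \<in> S" "i \<in> V" "u \<in> N i" "N i \<inter> S = {}" "priv S i = {}" if "i \<in> I" for i
    using that I DomD(1)[OF S] nb_in[of i] by (auto simp: lone_at_def lone_def)
  have "N x \<inter> insert u (S - I) \<noteq> {}" if x: "x \<in> V" "x \<notin> insert u (S - I)" for x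
  proof (cases "x \<in> I")
    case True
    then show ?thesis using I' by auto
  next
    case False
    then have xS: "x \<notin> S" "x \<noteq> u" using x by auto
    then obtain i where i: "i \<in> N x" "i \<in> S" using DomD(2)[OF S] x by auto
    show ?thesis
    proof (cases "i \<in> I")
      case True
      \<comment> \<open>A lone \<open>i\<close> has no private neighbor, so \<open>x\<close> has a
        second neighbor in \<open>S\<close>.\<close>
      then have "x \<notin> priv S i" using I' by auto
      then obtain j where j: "j \<in> N x" "j \<in> S" "j \<noteq> i"
        using i x xS by (auto simp: priv_def)
      \<comment> \<open>Otherwise \<open>x\<close>, \<open>i\<close>, \<open>u\<close>,
        \<open>j\<close> would form a 4-cycle.\<close>
      have "j \<notin> I"
        using I' N_sym j i True no_square[of i x u j] xS by metis
      then show ?thesis using j by auto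
    qed (use i in auto)
  qed
  then show "insert u (S - I) \<in> Dom"
    using DomD(1)[OF S] uV by (auto simp: Dom_def)
  show "priv (insert u (S - I)) u = I"
  proof (intro equalityI subsetI)
    fix v assume v: "v \<in> priv (insert u (S - I)) u"
    then have v': "v \<in> V" "v \<notin> insert u (S - I)" "N v \<inter> insert u (S - I) = {u}"
      by (auto simp: priv_def)
    show "v \<in> I"
    proof (rule ccontr)
      assume "v \<notin> I"
      then have "v \<notin> S" using v'(2) by blast
      then obtain i where "i \<in> N v" "i \<in> S" using DomD(2)[OF S v'(1)] by blast
      then have "i \<in> I" using v'(3) uV(2) by (metis DiffI IntI insertI2 singletonD)
      \<comment> \<open>The vertices \<open>u\<close>, \<open>i\<close>, \<open>v\<close> would form
        a triangle.\<close>
      then show False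
        using no_triangle[OF \<open>i \<in> N v\<close>, of u] I'(3) v'(3) by blast
    qed
  next
    fix v assume "v \<in> I"
    then show "v \<in> priv (insert u (S - I)) u"
      using I'[of v] uV by (auto simp: priv_def)
  qed
qed

text \<open>The exchange maps the pairs of \<open>S\<close> and a nonempty \<open>I\<close>
  injectively to dominating sets containing \<open>u\<close>: \<open>I\<close> is the set of private
  neighbors of \<open>u\<close> in the image, and removing \<open>u\<close> and restoring
  \<open>I\<close> gives back \<open>S\<close>.\<close>

lemma sum_Pow_lone_at_le:
  "(\<Sum>S\<in>{S \<in> Dom. u \<in> multi S}. \<Sum>I\<in>Pow (lone_at S u). card I - 1)
     \<le> (\<Sum>S\<in>{S \<in> Dom. u \<in> S}. card (priv S u) - 1)"
proof -
  define B where "B = (SIGMA S:{S \<in> Dom. u \<in> multi S}. Pow (lone_at S u) - {{}})"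
  define \<phi> where "\<phi> = (\<lambda>(S, I). insert u (S - I))"
  have \<phi>: "\<phi> (S, I) \<in> Dom" "u \<in> \<phi> (S, I)" "priv (\<phi> (S, I)) u = I" "(\<phi> (S, I) - {u}) \<union> I = S"
    if "(S, I) \<in> B" for S I
  proof -
    from that have *: "S \<in> Dom" "u \<in> multi S" "I \<subseteq> lone_at S u" by (auto simp: B_def)
    show "\<phi> (S, I) \<in> Dom" "u \<in> \<phi> (S, I)" "priv (\<phi> (S, I)) u = I"
      using exchange_lone[OF *] by (auto simp: \<phi>_def)
    show "(\<phi> (S, I) - {u}) \<union> I = S"
      using * by (auto simp: \<phi>_def multi_def lone_at_def lone_def)
  qed
  have inj: "inj_on \<phi> B"
    by (rule inj_onI) (metis \<phi>(3,4) surj_pair)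
  have "(\<Sum>S\<in>{S \<in> Dom. u \<in> multi S}. \<Sum>I\<in>Pow (lone_at S u). card I - 1)
      = (\<Sum>S\<in>{S \<in> Dom. u \<in> multi S}. \<Sum>I\<in>Pow (lone_at S u) - {{}}. card I - 1)"
    by (intro sum.cong refl sum.mono_neutral_right) (auto simp: finite_lone_at)
  also have "\<dots> = (\<Sum>(S, I)\<in>B. card I - 1)"
    unfolding B_def by (rule sum.Sigma) (auto simp: finite_Dom finite_lone_at)
  also have "\<dots> = (\<Sum>p\<in>B. card (priv (\<phi> p) u) - 1)"
    by (intro sum.cong) (auto simp: \<phi>(3))
  also have "\<dots> = (\<Sum>S\<in>\<phi> ` B. card (priv S u) - 1)"
    by (simp add: sum.reindex[OF inj])
  also have "\<dots> \<le> (\<Sum>S\<in>{S \<in> Dom. u \<in> S}. card (priv S u) - 1)"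
    by (rule sum_mono2) (auto simp: finite_Dom \<phi>)
  finally show ?thesis .
qed

text \<open>By \<open>card_le_Suc_sum_Pow\<close> every summand here is nonnegative, so
  \<open>slack u\<close> is too, and if it is zero all summands vanish.\<close>

lemma sum_le_slack:
  "(\<Sum>S\<in>{S \<in> Dom. u \<in> multi S}.
      1 + int (\<Sum>I\<in>Pow (lone_at S u). card I - 1) - int (card (lone_at S u))) \<le> slack u"
proof -
  have "(\<Sum>S\<in>{S \<in> Dom. u \<in> multi S}. int (\<Sum>I\<in>Pow (lone_at S u). card I - 1))
     \<le> (\<Sum>S\<in>{S \<in> Dom. u \<in> S}. int (card (priv S u) - 1))"
    using sum_Pow_lone_at_le[of u] by (simp only: of_nat_le_iff flip: of_nat_sum)
  then show ?thesis by (simp add: slack_def sum.distrib sum_subtractf del: of_nat_sum)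
qed

lemma slack_nonneg: "0 \<le> slack u"
proof (rule order_trans[OF sum_nonneg sum_le_slack])
  fix S assume "S \<in> {S \<in> Dom. u \<in> multi S}"
  then show "0 \<le> 1 + int (\<Sum>I\<in>Pow (lone_at S u). card I - 1) - int (card (lone_at S u))"
    using card_le_Suc_sum_Pow(1)[OF finite_lone_at, of S u] by (simp del: of_nat_sum)
qed

section \<open>The equality case\<close>

definition leaves :: "'a \<Rightarrow> 'a set" where
  "leaves u = {v. N v = {u}}"

lemma leaves_subset: "leaves u \<subseteq> N u"
  using N_sym by (auto simp: leaves_def)

lemma nb_leaf: "v \<in> leaves u \<Longrightarrow> nb v = u"
  by (simp add: leaves_def nb_def)

lemma finite_leaves: "finite (leaves u)"
  using leaves_subset N_subset finite_V by (meson finite_subset)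

text \<open>For the dominating set \<open>V - {u}\<close> the lone vertices assigned to \<open>u\<close> are its leaf neighbors.\<close>

lemma card_leaves_if_slack_0:
  assumes "slack u = 0" "u \<in> V" "\<forall>w. N u \<noteq> {w}"
  shows "card (leaves u) \<in> {1, 2}"
proof -
  let ?S = "V - {u}"
  have Nu: "N u \<inter> ?S = N u" using N_subset N_irrefl by auto
  have S: "?S \<in> Dom" using assms(2) N_nonempty Nu by (auto simp: Dom_def)
  have multi: "u \<in> multi ?S" using assms Nu by (auto simp: multi_def)
  \<comment> \<open>The only vertex outside \<open>?S\<close> is \<open>u\<close>, and it has at
    least two neighbors there.\<close>
  have priv: "priv ?S v = {}" for v
    using assms(3) Nu by (auto simp: priv_def)
  have "lone_at ?S u = leaves u"
  proof (intro equalityI subsetI)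
    fix v assume "v \<in> lone_at ?S u"
    then have "v \<in> V" "N v \<inter> (V - {u}) = {}" by (auto simp: lone_at_def lone_def)
    then show "v \<in> leaves u" using N_subset[of v] N_nonempty[of v] by (auto simp: leaves_def)
  next
    fix v assume v: "v \<in> leaves u"
    then have "v \<in> N u" using leaves_subset by auto
    then have "v \<in> ?S" using N_subset N_irrefl by auto
    then show "v \<in> lone_at ?S u"
      using v priv nb_leaf[OF v] by (auto simp: lone_at_def lone_def leaves_def)
  qed
  moreover have "1 + int (\<Sum>I\<in>Pow (lone_at ?S u). card I - 1) - int (card (lone_at ?S u)) = 0"
  proof -
    let ?g = "\<lambda>S. 1 + int (\<Sum>I\<in>Pow (lone_at S u). card I - 1) - int (card (lone_at S u))"
    have nonneg: "0 \<le> ?g S" if "S \<in> Dom" for S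
      using card_le_Suc_sum_Pow(1)[OF finite_lone_at[OF that, of u]] by linarith
    have "sum ?g {S \<in> Dom. u \<in> multi S} \<le> 0" using sum_le_slack[of u] assms(1) by simp
    moreover have "0 \<le> sum ?g {S \<in> Dom. u \<in> multi S}"
      using nonneg by (intro sum_nonneg) auto
    ultimately have "sum ?g {S \<in> Dom. u \<in> multi S} = 0" by linarith
    then show ?thesis
      using S multi finite_Dom nonneg
      by (subst (asm) sum_nonneg_eq_0_iff) auto
  qed
  ultimately show ?thesis
    using card_le_Suc_sum_Pow(2)[OF finite_lone_at[OF S, of u]]
    by (simp del: of_nat_sum)
qed

text \<open>Having a single neighbor, \<open>u\<close> is never dominated twice from outside
  \<open>S\<close> and has at most one private neighbor.\<close>

lemma slack_leaf:
  assumes "N u = {w}"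
  shows "slack u = 0"
proof -
  have "u \<notin> multi S" if "S \<in> Dom" for S
    using that assms DomD(2)[OF that, of u] by (auto simp: multi_def)
  moreover have "card (priv S u) - 1 = 0" for S
  proof -
    have "priv S u \<subseteq> {w}" using assms N_sym by (auto simp: priv_def)
    then have "card (priv S u) \<le> card {w}" by (intro card_mono) auto
    then show ?thesis by simp
  qed
  ultimately show ?thesis by (simp add: slack_def cong: conj_cong)
qed

text \<open>A vertex missing from a dominating set forces all its leaf neighbors into it. This
  determines \<open>lone_at S u\<close> and confines \<open>priv S u\<close> to the leaves of
  \<open>u\<close>. With one leaf every summand is zero; with two, gains and losses are matched by
  swapping \<open>u\<close> with both leaves.\<close>

lemma slack_eq_0_if_leaves:
  assumes u: "u \<in> V" "\<forall>w. N u \<noteq> {w}"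
    and leaves: "\<And>v. v \<in> V \<Longrightarrow> \<forall>w. N v \<noteq> {w} \<Longrightarrow> card (leaves v) \<in> {1, 2}"
  shows "slack u = 0"
proof -
  have ex: "\<exists>l. l \<in> leaves v" if "v \<in> V" "\<forall>w. N v \<noteq> {w}" for v
    using leaves[OF that] by (cases "leaves v = {}") auto
  have leaf_in: "l \<in> S" if "S \<in> Dom" "v \<notin> S" "l \<in> leaves v" for S v l
  proof (rule ccontr)
    assume "l \<notin> S"
    moreover have "l \<in> V" "N l = {v}" using that leaves_subset[of v] N_subset[of v] by (auto simp: leaves_def)
    ultimately show False using DomD(2)[OF that(1), of l] that by auto
  qed
  have lone_at: "lone_at S u = leaves u" if S: "S \<in> Dom" "u \<in> multi S" for S
  proof (intro equalityI subsetI)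
    fix v assume v: "v \<in> lone_at S u"
    then have v': "v \<in> V" "N v \<inter> S = {}" "priv S v = {}" "nb v = u" "v \<in> S"
      using DomD(1)[OF S(1)] by (auto simp: lone_at_def lone_def)
    show "v \<in> leaves u"
    proof (cases "\<forall>w. N v \<noteq> {w}")
      case True
      \<comment> \<open>All neighbors of \<open>v\<close> lie outside \<open>S\<close>, so a leaf at
        \<open>v\<close> would be private to \<open>v\<close>.\<close>
      then obtain l where l: "l \<in> leaves v" using ex v'(1) by blast
      then have "l \<in> N v" "N l = {v}" using leaves_subset by (auto simp: leaves_def)
      then have "l \<in> priv S v" using v' N_subset[of v] by (auto simp: priv_def)
      then show ?thesis using v' by auto
    next
      case False
      then show ?thesis using v' nb_in[of v] by (auto simp: leaves_def)
    qed
  next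
    fix v assume v: "v \<in> leaves u"
    have "u \<notin> S" using S by (auto simp: multi_def)
    moreover have "v \<in> S" using leaf_in[OF S(1) _ v] \<open>u \<notin> S\<close> by blast
    moreover have "x \<notin> priv S v" for x
    proof
      assume "x \<in> priv S v"
      then have "v \<in> N x" and x: "N x \<inter> S = {v}" by (auto simp: priv_def)
      then have "x = u" using N_sym v by (auto simp: leaves_def)
      then show False using x S(2) by (simp add: multi_def)
    qed
    ultimately show "v \<in> lone_at S u"
      using v nb_leaf[OF v] by (auto simp: lone_at_def lone_def leaves_def)
  qed
  have priv_leaves: "priv S u \<subseteq> leaves u" if S: "S \<in> Dom" for S
  proof
    fix v assume "v \<in> priv S u"
    then have v: "v \<in> V" "v \<notin> S" "N v \<inter> S = {u}" by (auto simp: priv_def)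
    show "v \<in> leaves u"
    proof (cases "\<forall>w. N v \<noteq> {w}")
      case True
      \<comment> \<open>A leaf at the missing vertex \<open>v\<close> lies in \<open>S\<close>, so
        it is the only neighbor \<open>u\<close> of \<open>v\<close> in \<open>S\<close>; but
        \<open>u\<close> is not a leaf.\<close>
      then obtain l where l: "l \<in> leaves v" using ex v(1) by blast
      then have "l \<in> S" "l \<in> N v" using leaf_in[OF S v(2) l] leaves_subset l by auto
      then have "l = u" using v(3) by auto
      then show ?thesis using l u by (auto simp: leaves_def)
    next
      case False
      moreover have "u \<in> N v" using v(3) by auto
      ultimately show ?thesis by (auto simp: leaves_def)
    qed
  qed
  consider "card (leaves u) = 1" | "card (leaves u) = 2" using leaves[OF u] by auto
  then show ?thesis
  proof cases
    case 1
    have "card (priv S u) - 1 = 0" if "S \<in> Dom" for S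
      using card_mono[OF finite_leaves priv_leaves[OF that]] 1 by simp
    then show ?thesis using lone_at 1 by (simp add: slack_def)
  next
    case 2
    let ?L = "leaves u"
    \<comment> \<open>On \<open>?A\<close> the surplus of \<open>u\<close> is one; on
      \<open>?B\<close> two lone vertices face one unit, a loss of one.\<close>
    let ?A = "{S \<in> Dom. u \<in> S \<and> ?L \<inter> S = {}}" and ?B = "{S \<in> Dom. u \<in> multi S}"
    have uL: "u \<notin> ?L" using leaves_subset N_irrefl by auto
    have LV: "?L \<subseteq> V" using leaves_subset N_subset by blast
    have priv_card: "card (priv S u) - 1 = of_bool (?L \<inter> S = {})" if S: "S \<in> Dom" "u \<in> S" for S
    proof (cases "?L \<inter> S = {}")
      case True
      then have "?L \<subseteq> priv S u" using S LV by (auto simp: priv_def leaves_def)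
      then have "priv S u = ?L" using priv_leaves[OF S(1)] by auto
      then show ?thesis using True 2 by simp
    next
      case False
      then have "priv S u \<noteq> ?L" by (auto simp: priv_def)
      then have "card (priv S u) < card ?L"
        using priv_leaves[OF S(1)] finite_leaves by (metis psubsetI psubset_card_mono)
      then show ?thesis using 2 False by simp
    qed
    have to_B: "S - {u} \<union> ?L \<in> ?B" if "S \<in> ?A" for S
    proof -
      have S: "S \<in> Dom" "u \<in> S" "?L \<inter> S = {}" using that by auto
      \<comment> \<open>The vertex \<open>u\<close> is dominated by its leaves, any other non-leaf
        outside the set by its own leaf in \<open>S\<close>, and a leaf outside the set by its
        neighbor, which differs from \<open>u\<close>.\<close>
      have "N x \<inter> (S - {u} \<union> ?L) \<noteq> {}" if x: "x \<in> V" "x \<notin> S - {u} \<union> ?L" for x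
      proof (cases "x = u")
        case True
        then show ?thesis using ex[OF u] leaves_subset by auto
      next
        case False
        then have xS: "x \<notin> S" using x by auto
        show ?thesis
        proof (cases "\<forall>w. N x \<noteq> {w}")
          case True
          then obtain l where l: "l \<in> leaves x" using ex x(1) by blast
          then have "l \<in> S" "l \<in> N x" using leaf_in[OF S(1) xS l] leaves_subset l by auto
          moreover have "l \<noteq> u" using l u by (auto simp: leaves_def)
          ultimately show ?thesis by auto
        next
          case False
          then obtain w where w: "N x = {w}" by auto
          then have "w \<in> S" using DomD(2)[OF S(1), of x] x xS by auto
          moreover have "w \<noteq> u" using w x by (auto simp: leaves_def)
          ultimately show ?thesis using w by auto
        qed
      qed
      then have D: "S - {u} \<union> ?L \<in> Dom" using S LV DomD(1)[OF S(1)] by (auto simp: Dom_def)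
      have "N u \<inter> (S - {u} \<union> ?L) \<noteq> {w}" for w
      proof
        assume "N u \<inter> (S - {u} \<union> ?L) = {w}"
        then have "?L \<subseteq> {w}" using leaves_subset by auto
        then have "card ?L \<le> card {w}" by (intro card_mono) auto
        with 2 show False by simp
      qed
      then show ?thesis using D u uL by (auto simp: multi_def)
    qed
    \<comment> \<open>Here all of \<open>lone_at S u\<close>, that is both leaves, is
      exchanged.\<close>
    have to_A: "insert u (S - ?L) \<in> ?A" if "S \<in> ?B" for S
      using exchange_lone(1)[of S u ?L] lone_at[of S] that uL by auto
    have "bij_betw (\<lambda>S. S - {u} \<union> ?L) ?A ?B"
    proof (rule bij_betw_byWitness[where f' = "\<lambda>S. insert u (S - ?L)"])
      show "\<forall>S\<in>?A. insert u (S - {u} \<union> ?L - ?L) = S" using uL by auto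
      show "\<forall>S\<in>?B. insert u (S - ?L) - {u} \<union> ?L = S"
      proof
        fix S assume "S \<in> ?B"
        then have S: "S \<in> Dom" "u \<notin> S" by (auto simp: multi_def)
        then show "insert u (S - ?L) - {u} \<union> ?L = S" using leaf_in[OF S] by blast
      qed
    qed (use to_B to_A in auto)
    then have "card ?A = card ?B" by (rule bij_betw_same_card)
    moreover have "(\<Sum>S\<in>{S \<in> Dom. u \<in> S}. int (card (priv S u) - 1)) = int (card ?A)"
    proof -
      have "(\<Sum>S\<in>{S \<in> Dom. u \<in> S}. int (card (priv S u) - 1))
          = (\<Sum>S\<in>{S \<in> Dom. u \<in> S}. of_bool (?L \<inter> S = {}))"
        using priv_card by (intro sum.cong) auto
      also have "\<dots> = int (card ?A)"
        using finite_Dom by (simp add: Int_def conj_ac)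
      finally show ?thesis .
    qed
    moreover have "(\<Sum>S\<in>?B. 1 - int (card (lone_at S u))) = - int (card ?B)"
      using lone_at 2 by simp
    ultimately show ?thesis by (simp add: slack_def)
  qed
qed

lemma sum_card_Dom:
  shows "3 * (\<Sum>S\<in>Dom. int (card S)) \<le> 2 * int (card V) * int (card Dom)"
    and "3 * (\<Sum>S\<in>Dom. int (card S)) = 2 * int (card V) * int (card Dom) \<longleftrightarrow>
      (\<forall>u\<in>V. (\<forall>w. N u \<noteq> {w}) \<longrightarrow> card (leaves u) \<in> {1, 2})"
proof -
  show "3 * (\<Sum>S\<in>Dom. int (card S)) \<le> 2 * int (card V) * int (card Dom)"
    using sum_slack sum_nonneg[of V slack] slack_nonneg by simp
  have "3 * (\<Sum>S\<in>Dom. int (card S)) = 2 * int (card V) * int (card Dom)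
      \<longleftrightarrow> (\<forall>u\<in>V. slack u = 0)"
    using sum_slack sum_nonneg_eq_0_iff[OF finite_V slack_nonneg] by auto
  also have "\<dots> \<longleftrightarrow> (\<forall>u\<in>V. (\<forall>w. N u \<noteq> {w}) \<longrightarrow> card (leaves u) \<in> {1, 2})"
    using card_leaves_if_slack_0 slack_leaf slack_eq_0_if_leaves by meson
  finally show "3 * (\<Sum>S\<in>Dom. int (card S)) = 2 * int (card V) * int (card Dom) \<longleftrightarrow>
      (\<forall>u\<in>V. (\<forall>w. N u \<noteq> {w}) \<longrightarrow> card (leaves u) \<in> {1, 2})" .
qed

end

section \<open>From trees to the neighborhood setting and the average order\<close>

lemma undirected_tree_girth_five_graph:
  assumes "undirected_tree G" and "2 \<le> card (pverts G)"
  shows "girth_five_graph (pverts G) (\<lambda>v. {w. (v, w) \<in> parcs G})"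
proof -
  interpret pair_graph G using assms by (simp add: undirected_tree_def)
  have sym: "(v, u) \<in> parcs G" if "(u, v) \<in> parcs G" for u v
    using that pair_sym_arcs by (auto simp: symmetric_def dest: symD)
  have irrefl: "u \<noteq> v" if "(u, v) \<in> parcs G" for u v
    using pair_no_loops[OF that] by auto
  \<comment> \<open>Written with arc lists of the pair graph, so that explicit cycles of length 3
    and 4 can be refuted by simplification.\<close>
  have acyclic: "\<not> (pcas u p u \<and> u \<in> pverts G \<and> set p \<subseteq> parcs G \<and>
      distinct (tl (pawalk_verts u p)) \<and> 3 \<le> length p)" for u p
    using assms(1) unfolding undirected_tree_def pre_digraph.cycle_def pre_digraph.awalk_def
    by (force simp: cas_with_proj_eq awalk_verts_with_proj_eq)
  show ?thesis
  proof
    show "finite (pverts G)" by (rule pair_finite_verts)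
    show "{w. (v, w) \<in> parcs G} \<subseteq> pverts G" for v using in_arcsD2 by auto
    show "v \<in> {w. (u, w) \<in> parcs G}" if "u \<in> {w. (v, w) \<in> parcs G}" for u v
      using that sym by auto
    show "v \<notin> {w. (v, w) \<in> parcs G}" for v using irrefl by auto
    show "{w. (v, w) \<in> parcs G} \<noteq> {}" if v: "v \<in> pverts G" for v
    proof -
      have "\<not> pverts G \<subseteq> {v}"
        using assms(2) card_mono[of "{v}" "pverts G"] by auto
      then obtain w where w: "w \<in> pverts G" "w \<noteq> v" by auto
      \<comment> \<open>Connectedness refers to the symmetric closure, which has the same
        reachability as the symmetric \<open>G\<close>. The first arc of a path to \<open>w\<close>
        gives a neighbor of \<open>v\<close>.\<close>
      have "v \<rightarrow>\<^sup>*\<^bsub>with_proj (mk_symmetric (with_proj G))\<^esub> w"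
        using assms(1) v w(1) by (auto simp: undirected_tree_def connected_def strongly_connected_def)
      then have "v \<rightarrow>\<^sup>*\<^bsub>with_proj G\<^esub> w"
        using pair_sym_arcs by (simp add: reachable_mk_symmetric_eq)
      then show ?thesis
        unfolding reachable_def using w(2) by (cases rule: converse_rtrancl_on_cases) auto
    qed
    show "w \<notin> {w. (u, w) \<in> parcs G}"
      if "u \<in> {w. (v, w) \<in> parcs G}" "w \<in> {w. (v, w) \<in> parcs G}" for u v w
      using that sym irrefl acyclic[of v "[(v, u), (u, w), (w, v)]"] in_arcsD1 by auto
    show "x = y"
      if "x \<in> {w. (u, w) \<in> parcs G}" "x \<in> {v. (w, v) \<in> parcs G}"
        "y \<in> {w. (u, w) \<in> parcs G}" "y \<in> {v. (w, v) \<in> parcs G}" "u \<noteq> w" for x u w y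
      using that sym irrefl acyclic[of u "[(u, x), (x, w), (w, y), (y, u)]"] in_arcsD1 by auto
  qed
qed

theorem theorem1p2:
  fixes G :: "'a pair_pre_digraph" and n :: nat
  assumes "undirected_tree G"
    and "card (pverts G) = n"
    and "n \<ge> 2"
  shows "avd G \<le> 2 * real n / 3 \<and>
    (avd G = 2 * real n / 3 \<longleftrightarrow>
      (\<forall>v \<in> pverts G. \<not> leaf G v \<longrightarrow>
         support_vertex G v \<and> card (leaf_neighbors G v) \<in> {1, 2}))"
proof -
  define N where "N = (\<lambda>v. {w. (v, w) \<in> parcs G})"
  interpret girth_five_graph "pverts G" N
    unfolding N_def using assms by (intro undirected_tree_girth_five_graph) auto
  have Dom: "dominating_sets G = Dom"
    unfolding Dom_def by (auto simp: dominating_sets_def dominating_set_def N_def)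
  have "out_arcs (with_proj G) v = Pair v ` N v" for v
    by (auto simp: N_def out_arcs_def)
  then have "out_degree (with_proj G) v = card (N v)" for v
    by (simp add: out_degree_def card_image inj_on_def)
  then have leaf: "leaf G v \<longleftrightarrow> v \<in> pverts G \<and> (\<exists>w. N v = {w})" for v
    by (auto simp: leaf_def card_1_singleton_iff)
  have leaves: "leaf_neighbors G u = leaves u" for u
  proof -
    have "leaf_neighbors G u = {w \<in> N u. w \<in> pverts G \<and> (\<exists>x. N w = {x})}"
      by (auto simp: leaf_neighbors_def leaf) (auto simp: N_def)
    moreover have "x = u" if "w \<in> N u" "N w = {x}" for w x
      using N_sym[OF that(1)] that(2) by simp
    ultimately show ?thesis
      using N_subset[of u] leaves_subset[of u] by (auto simp: leaves_def)
  qed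
  \<comment> \<open>A positive number of leaf neighbors already makes \<open>u\<close> a support
    vertex, so the equality condition reduces to the count.\<close>
  have support: "support_vertex G u" if "u \<in> pverts G" "card (leaf_neighbors G u) \<in> {1, 2}" for u
  proof -
    have "leaf_neighbors G u \<noteq> {}" using that(2) by auto
    then show ?thesis using that(1) by (auto simp: support_vertex_def leaf_neighbors_def)
  qed
  \<comment> \<open>The denominator of \<open>avd\<close> is thus positive and can be cleared,
    leaving an integer comparison.\<close>
  have "pverts G \<in> Dom" by (simp add: Dom_def)
  then have "0 < card Dom" using finite_Dom by (auto simp: card_gt_0_iff)
  define s where "s = (\<Sum>S\<in>Dom. int (card S))"
  have avd: "avd G = real_of_int s / real (card Dom)"
    by (simp add: avd_def Dom s_def)
  have le: "avd G \<le> 2 * real n / 3 \<longleftrightarrow> 3 * s \<le> 2 * int n * int (card Dom)"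
    using \<open>0 < card Dom\<close> unfolding avd
    by (simp add: field_simps flip: of_int_le_iff[where 'a = real])
  have eq: "avd G = 2 * real n / 3 \<longleftrightarrow> 3 * s = 2 * int n * int (card Dom)"
    using \<open>0 < card Dom\<close> unfolding avd
    by (simp add: field_simps flip: of_int_eq_iff[where 'a = real])
  show ?thesis
    using sum_card_Dom support leaves leaf assms(2) unfolding le eq s_def by auto
qed

end
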